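(* For every even integer $k\ge 0$, $M_{k,\mathrm{T}\cdots\mathrm{F}}=\sqrt{2}^{\,k}$. For every odd integer $k\ge 1$, $1.5\,\sqrt{2}^{\,k-1}\le M_{k,\mathrm{T}\cdots\mathrm{F}}\le\sqrt{2}^{\,k+1}$.
   Context: Unordered CNF game: an instance is a pair $(\varphi,X)$ where $\varphi$ is a CNF formula (a set of clauses, each clause a disjunction of literals $x_i$ or $\overline{x}_i$) and $X$ is a finite set of boolean variables containing every variable appearing in $\varphi$ (and possibly more). Two players, T and F, alternate turns; on each turn the player picks a not-yet-assigned variable from $X$ and assigns it the value $0$ or $1$ of their choice. The game ends when all variables of $X$ are assigned; T wins if $\varphi$ is satisfied and F wins otherwise. If the same player moves first and last then $|X|$ is odd; if different players move first and last then $|X|$ is even. A CNF is $k$-uniform if every clause has exactly $k$ literals, on $k$ distinct variables. For $k\ge 0$ and $a,b\in\{\mathrm{T},\mathrm{F}\}$, $M_{k,a\cdots b}$ denotes the minimum number of clauses of $\varphi$ over all instances $(\varphi,X)$ with $\varphi$ $k$-uniform such that F has a winning strategy when player $a$ makes the first move and player $b$ makes the last move. *)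

theory Defs
  imports Complex_Main
begin

datatype 'v literal = Pos 'v | Neg 'v

fun lit_var :: "'v literal \<Rightarrow> 'v" where
  "lit_var (Pos x) = x"
| "lit_var (Neg x) = x"

fun lit_holds :: "('v \<Rightarrow> bool) \<Rightarrow> 'v literal \<Rightarrow> bool" where
  "lit_holds \<alpha> (Pos x) = \<alpha> x"
| "lit_holds \<alpha> (Neg x) = (\<not> \<alpha> x)"

type_synonym 'v clause = "'v literal set"
type_synonym 'v cnf = "'v clause set"

definition satisfies :: "('v \<Rightarrow> bool) \<Rightarrow> 'v cnf \<Rightarrow> bool" where
  "satisfies \<alpha> \<phi> \<longleftrightarrow> (\<forall>C\<in>\<phi>. \<exists>l\<in>C. lit_holds \<alpha> l)"

text \<open>The finiteness condition matters for \<open>k = 0\<close>, since \<open>card\<close> is \<open>0\<close> on infinite sets.\<close>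

definition uniform :: "nat \<Rightarrow> 'v cnf \<Rightarrow> bool" where
  "uniform k \<phi> \<longleftrightarrow> (\<forall>C\<in>\<phi>. finite C \<and> card C = k \<and> card (lit_var ` C) = k)"

definition game_instance :: "'v cnf \<Rightarrow> 'v set \<Rightarrow> bool" where
  "game_instance \<phi> X \<longleftrightarrow> finite \<phi> \<and> finite X \<and> (\<forall>C\<in>\<phi>. lit_var ` C \<subseteq> X)"

datatype player = Player_T | Player_F

fun opponent :: "player \<Rightarrow> player" where
  "opponent Player_T = Player_F"
| "opponent Player_F = Player_T"

text \<open>A history lists the moves made so far, oldest first; a move \<open>(x, v)\<close> assigns \<open>v\<close> to \<open>x\<close>.\<close>

type_synonym 'v history = "('v \<times> bool) list"
type_synonym 'v strategy = "'v history \<Rightarrow> 'v \<times> bool"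

text \<open>The player who makes the move with (zero-based) index \<open>i\<close> when \<open>a\<close> moves first.\<close>

definition mover :: "player \<Rightarrow> nat \<Rightarrow> player" where
  "mover a i = (if even i then a else opponent a)"

definition legal_history :: "'v set \<Rightarrow> 'v history \<Rightarrow> bool" where
  "legal_history X h \<longleftrightarrow> distinct (map fst h) \<and> fst ` set h \<subseteq> X"

definition complete_history :: "'v set \<Rightarrow> 'v history \<Rightarrow> bool" where
  "complete_history X h \<longleftrightarrow> legal_history X h \<and> fst ` set h = X"

definition assignment_of :: "'v history \<Rightarrow> 'v \<Rightarrow> bool" where
  "assignment_of h x \<longleftrightarrow> (x, True) \<in> set h"

definition follows :: "player \<Rightarrow> player \<Rightarrow> 'v strategy \<Rightarrow> 'v history \<Rightarrow> bool" where
  "follows a p \<sigma> h \<longleftrightarrow> (\<forall>i<length h. mover a i = p \<longrightarrow> h ! i = \<sigma> (take i h))"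

definition winning_strategy_F :: "'v cnf \<Rightarrow> 'v set \<Rightarrow> player \<Rightarrow> 'v strategy \<Rightarrow> bool" where
  "winning_strategy_F \<phi> X a \<sigma> \<longleftrightarrow>
     (\<forall>h. legal_history X h \<and> follows a Player_F \<sigma> h \<and> \<not> complete_history X h
            \<and> mover a (length h) = Player_F
          \<longrightarrow> fst (\<sigma> h) \<in> X - fst ` set h) \<and>
     (\<forall>h. complete_history X h \<and> follows a Player_F \<sigma> h
          \<longrightarrow> \<not> satisfies (assignment_of h) \<phi>)"

definition F_wins :: "'v cnf \<Rightarrow> 'v set \<Rightarrow> player \<Rightarrow> bool" where
  "F_wins \<phi> X a \<longleftrightarrow> (\<exists>\<sigma>. winning_strategy_F \<phi> X a \<sigma>)"

text \<open>
  When \<open>a\<close> moves first, \<open>b\<close> moves last: with strict alternation this is a condition on the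
  parity of \<open>card X\<close>. The game without moves (\<open>X = {}\<close>) is admitted for \<open>a \<noteq> b\<close>.
\<close>

definition pattern :: "player \<Rightarrow> player \<Rightarrow> 'v set \<Rightarrow> bool" where
  "pattern a b X \<longleftrightarrow> (odd (card X) \<longleftrightarrow> a = b)"

text \<open>
  Variables are natural numbers: instances are finite, so this covers all of them up to
  renaming. On \<open>nat\<close>, \<open>Inf\<close> of a nonempty set is its minimum, while \<open>Inf {} = 0\<close>; hence a
  positive value of \<open>min_clauses\<close> entails that a qualifying instance exists.
\<close>

definition min_clauses :: "nat \<Rightarrow> player \<Rightarrow> player \<Rightarrow> nat" where
  "min_clauses k a b =
     Inf {card \<phi> | (\<phi> :: nat cnf) X.
            game_instance \<phi> X \<and> uniform k \<phi> \<and> pattern a b X \<and> F_wins \<phi> X a}"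

end

theory Submission
  imports Defs
begin

text \<open>
  Lower bound: a clause that is not yet satisfied and has \<open>j\<close> unassigned literals gets weight
  \<open>2\<^bsup>-i\<^esup>\<close> if \<open>j = 2i\<close>, and \<open>(2/3) 2\<^bsup>-i\<^esup>\<close> if \<open>j = 2i + 1\<close>.
  Falsifying one literal multiplies the weight by at most \<open>3/2\<close>, falsifying two by exactly \<open>2\<close>.
  If T always makes true a literal \<open>l\<close> that maximises the weight of the clauses containing
  \<open>l\<close> minus the weight of those containing its negation, the total weight does not increase
  over a round consisting of a move of T and any reply of F. Hence F needs initial weight at least \<open>1\<close>.

  Upper bound: the variables form pairs, and F copies the value of T's last move to the partner
  variable. There is one clause for each choice of a common sign for every pair.
\<close>

section \<open>Literals as moves, and legal histories\<close>

definition lit :: "'v \<Rightarrow> bool \<Rightarrow> 'v literal" where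
  "lit x v = (if v then Pos x else Neg x)"

lemma lit_var_lit [simp]: "lit_var (lit x v) = x"
  by (simp add: lit_def)

lemma lit_holds_lit [simp]: "lit_holds \<alpha> (lit x v) \<longleftrightarrow> \<alpha> x = v"
  by (simp add: lit_def)

lemma lit_eq_iff [simp]: "lit x v = lit y u \<longleftrightarrow> x = y \<and> v = u"
  by (auto simp: lit_def)

lemma lit_exhaust: obtains x v where "l = lit x v"
  by (cases l) (metis lit_def)+

lemma follows_snoc:
  "follows a p \<sigma> (h @ [m]) \<longleftrightarrow>
     follows a p \<sigma> h \<and> (mover a (length h) = p \<longrightarrow> m = \<sigma> h)"
  by (auto simp: follows_def nth_append less_Suc_eq)

lemma follows_Nil [simp]: "follows a p \<sigma> []"
  by (simp add: follows_def)

lemma legal_history_snoc: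
  "legal_history X (h @ [m]) \<longleftrightarrow> legal_history X h \<and> fst m \<in> X - fst ` set h"
  by (auto simp: legal_history_def)

lemma legal_history_Nil [simp]: "legal_history X []"
  by (simp add: legal_history_def)

lemma legal_history_length:
  "legal_history X h \<Longrightarrow> length h = card (fst ` set h)"
  by (metis legal_history_def distinct_card length_map set_map)

lemma complete_history_iff_length:
  assumes "finite X" "legal_history X h"
  shows "complete_history X h \<longleftrightarrow> length h = card X"
  using assms legal_history_length[OF assms(2)] card_subset_eq[of X "fst ` set h"]
  by (auto simp: complete_history_def legal_history_def)


section \<open>The potential of a position\<close>

definition weight :: "nat \<Rightarrow> real" where
  "weight j = (if even j then 1 else 2 / 3) / 2 ^ (j div 2)"

lemma weight_pos: "weight j > 0"
  by (simp add: weight_def)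

text \<open>Equality holds at even \<open>j\<close>, which is where the constant 2/3 comes from. At
  odd \<open>j\<close>, after cancelling the powers of two, the claim is 2/3 \<le> 3/4.\<close>

lemma weight_Suc: "weight j \<le> 3 / 2 * weight (Suc j)"
proof (cases "even j")
  case True
  then show ?thesis by (simp add: weight_def)
next
  case False
  then have "Suc j div 2 = Suc (j div 2)" by presburger
  with False show ?thesis by (simp add: weight_def field_simps)
qed

lemma weight_Suc_Suc: "weight j = 2 * weight (Suc (Suc j))"
  by (simp add: weight_def)

definition clause_weight :: "'v history \<Rightarrow> 'v clause \<Rightarrow> real" where
  "clause_weight h C =
     (if \<exists>m\<in>set h. lit (fst m) (snd m) \<in> C then 0
      else weight (card {l\<in>C. lit_var l \<notin> fst ` set h}))"

definition potential :: "'v cnf \<Rightarrow> 'v history \<Rightarrow> real" where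
  "potential \<phi> h = (\<Sum>C\<in>\<phi>. clause_weight h C)"

definition sign_in :: "'v clause \<Rightarrow> 'v \<times> bool \<Rightarrow> real" where
  "sign_in C m =
     of_bool (lit (fst m) (snd m) \<in> C) - of_bool (lit (fst m) (\<not> snd m) \<in> C)"

definition bias :: "'v cnf \<Rightarrow> 'v history \<Rightarrow> 'v \<times> bool \<Rightarrow> real" where
  "bias \<phi> h m = (\<Sum>C\<in>\<phi>. clause_weight h C * sign_in C m)"

lemma bias_flip: "bias \<phi> h (x, \<not> v) = - bias \<phi> h (x, v)"
  by (simp add: bias_def sign_in_def sum_negf [symmetric] algebra_simps)

text \<open>The factor 1 - (sum of the two signs) / 2 is nonnegative when the round satisfies
  \<open>C\<close>; otherwise it is 1, 3/2 or 2 when the round falsifies no, one or two literals of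
  \<open>C\<close>. Both signs multiply the weight before the round and the bound is linear in them,
  so summing over the clauses yields the biases of the two moves at \<open>h\<close>.\<close>

lemma clause_weight_round:
  fixes C :: "'v clause"
  assumes C: "finite C" "inj_on lit_var C"
    and new: "x \<notin> fst ` set h" "y \<notin> fst ` set h" "x \<noteq> y"
  shows "clause_weight (h @ [(x, v), (y, u)]) C \<le>
    clause_weight h C - clause_weight h C * (sign_in C (x, v) + sign_in C (y, u)) / 2"
proof (cases "\<exists>m\<in>set h. lit (fst m) (snd m) \<in> C")
  case True
  then show ?thesis by (simp add: clause_weight_def)
next
  case False
  define R where "R = {l\<in>C. lit_var l \<notin> fst ` set h}"
  have finR: "finite R" using C by (simp add: R_def)
  have old: "clause_weight h C = weight (card R)"
    using False by (simp add: clause_weight_def R_def)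
  have pos: "weight (card R) > 0" by (rule weight_pos)
  have not_both: "lit z (\<not> s) \<notin> C" if "lit z s \<in> C" for z s
    using inj_onD[OF C(2), of "lit z s" "lit z (\<not> s)"] that by auto
  show ?thesis
  proof (cases "lit x v \<in> C \<or> lit y u \<in> C")
    case True
    then have "clause_weight (h @ [(x, v), (y, u)]) C = 0"
      by (auto simp: clause_weight_def)
    moreover have "sign_in C (x, v) \<le> 1" "sign_in C (y, u) \<le> 1"
      by (auto simp: sign_in_def)
    then have "weight (card R) * (sign_in C (x, v) + sign_in C (y, u)) \<le> weight (card R) * 2"
      using pos by (intro mult_left_mono) auto
    ultimately show ?thesis
      unfolding old by simp
  next
    case unsat: False
    \<comment> \<open>The literals of \<open>C\<close> that the move \<open>(z, s)\<close>
      falsifies: at most one.\<close>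
    let ?n = "\<lambda>z s. if lit z (\<not> s) \<in> C then {lit z (\<not> s)} else {}"
    have "{l\<in>C. lit_var l \<notin> fst ` set (h @ [(x, v), (y, u)])} = R - (?n x v \<union> ?n y u)"
      (is "?R' = _")
    proof -
      have eq: "lit z t \<in> ?R' \<longleftrightarrow> lit z t \<in> R - (?n x v \<union> ?n y u)" for z t
      proof -
        have "s = (\<not> t)" if "lit z s \<notin> C" "lit z t \<in> C" for s
          using that by (cases s; cases t) auto
        with unsat show ?thesis
          by (cases "z = x"; cases "z = y") (auto simp: R_def)
      qed
      show ?thesis
      proof (intro set_eqI)
        fix l :: "'v literal"
        obtain z t where "l = lit z t" by (rule lit_exhaust)
        with eq[of z t] show "l \<in> ?R' \<longleftrightarrow> l \<in> R - (?n x v \<union> ?n y u)" by (simp only:)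
      qed
    qed
    moreover have "?n x v \<union> ?n y u \<subseteq> R"
      using new by (auto simp: R_def split: if_splits)
    moreover have "card (?n x v \<union> ?n y u) =
        of_bool (lit x (\<not> v) \<in> C) + of_bool (lit y (\<not> u) \<in> C)"
      using new(3) by auto
    ultimately have cardR: "card R = card ?R' +
        (of_bool (lit x (\<not> v) \<in> C) + of_bool (lit y (\<not> u) \<in> C))"
      using card_Diff_subset[of "?n x v \<union> ?n y u" R] finR card_mono[of R "?n x v \<union> ?n y u"]
      by simp
    have after: "clause_weight (h @ [(x, v), (y, u)]) C = weight (card ?R')"
      using False unsat by (simp add: clause_weight_def)
    show ?thesis
      unfolding after old cardR sign_in_def
      using unsat weight_Suc[of "card ?R'"] weight_Suc_Suc[of "card ?R'"]
      by (auto simp: algebra_simps)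
  qed
qed

text \<open>The change is at most minus half the sum of the two biases. Since negating a literal
  negates its bias, \<open>greedy\<close> says exactly that this sum is nonnegative.\<close>

lemma potential_round:
  assumes "\<And>C. C \<in> \<phi> \<Longrightarrow> finite C \<and> inj_on lit_var C"
    and "x \<notin> fst ` set h" "y \<notin> fst ` set h" "x \<noteq> y"
    and greedy: "bias \<phi> h (y, \<not> u) \<le> bias \<phi> h (x, v)"
  shows "potential \<phi> (h @ [(x, v), (y, u)]) \<le> potential \<phi> h"
proof -
  have "potential \<phi> (h @ [(x, v), (y, u)]) \<le> (\<Sum>C\<in>\<phi>. clause_weight h C -
      clause_weight h C * (sign_in C (x, v) + sign_in C (y, u)) / 2)"
    unfolding potential_def using assms by (intro sum_mono clause_weight_round) auto
  also have "\<dots> = potential \<phi> h - (bias \<phi> h (x, v) + bias \<phi> h (y, u)) / 2"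
    by (simp add: potential_def bias_def sum_subtractf sum_divide_distrib [symmetric]
        distrib_left sum.distrib)
  also have "\<dots> \<le> potential \<phi> h"
    using greedy by (simp add: bias_flip)
  finally show ?thesis .
qed

section \<open>The lower bound on the number of clauses\<close>

lemma uniform_clause:
  assumes "uniform k \<phi>" "C \<in> \<phi>"
  shows "finite C \<and> inj_on lit_var C"
  using assms by (auto simp: uniform_def intro: eq_card_imp_inj_on)

lemma potential_Nil: "uniform k \<phi> \<Longrightarrow> potential \<phi> [] = card \<phi> * weight k"
  by (simp add: potential_def clause_weight_def uniform_def)

text \<open>A falsified clause has no unassigned literal left, so it alone contributes
  \<open>weight 0\<close>, which is 1; all other contributions are nonnegative.\<close>

lemma potential_complete:
  assumes "finite \<phi>" "\<And>C. C \<in> \<phi> \<Longrightarrow> lit_var ` C \<subseteq> X"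
    and h: "complete_history X h" and unsat: "\<not> satisfies (assignment_of h) \<phi>"
  shows "potential \<phi> h \<ge> 1"
proof -
  obtain C where C: "C \<in> \<phi>" "\<And>l. l \<in> C \<Longrightarrow> \<not> lit_holds (assignment_of h) l"
    using unsat by (auto simp: satisfies_def)
  have dist: "distinct (map fst h)"
    using h by (simp add: complete_history_def legal_history_def)
  have "lit x v \<notin> C" if "(x, v) \<in> set h" for x v
  proof
    assume "lit x v \<in> C"
    then have "assignment_of h x \<noteq> v" using C(2) by fastforce
    \<comment> \<open>Now \<open>x\<close> would occur in \<open>h\<close> with both values,
      although it is assigned only once.\<close>
    with that have "\<not> v" "(x, True) \<in> set h" by (auto simp: assignment_of_def)
    with that dist show False by (metis eq_key_imp_eq_value)
  qed
  moreover have "{l\<in>C. lit_var l \<notin> fst ` set h} = {}"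
    using assms(2)[OF C(1)] h by (auto simp: complete_history_def)
  ultimately have "clause_weight h C = weight 0"
    unfolding clause_weight_def by (metis card.empty prod.collapse)
  then have "clause_weight h C = 1"
    by (simp add: weight_def)
  moreover have "clause_weight h D \<ge> 0" for D
    using weight_pos by (auto simp: clause_weight_def less_imp_le)
  ultimately show ?thesis
    using member_le_sum[of C \<phi> "clause_weight h"] C(1) assms(1) by (simp add: potential_def)
qed

text \<open>Greedy play of T against F's winning strategy gives a complete history whose potential
  is at least 1 and at most the initial potential.\<close>

lemma F_wins_imp_card_ge:
  assumes "game_instance \<phi> X" "uniform k \<phi>" "pattern Player_T Player_F X"
    and win: "F_wins \<phi> X Player_T"
  shows "card \<phi> * weight k \<ge> 1"
proof -
  have fin: "finite \<phi>" "finite X" and vars: "\<And>C. C \<in> \<phi> \<Longrightarrow> lit_var ` C \<subseteq> X"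
    using assms(1) by (auto simp: game_instance_def)
  have ev: "even (card X)" using assms(3) by (simp add: pattern_def)
  obtain \<sigma> where \<sigma>: "winning_strategy_F \<phi> X Player_T \<sigma>"
    using win by (auto simp: F_wins_def)
  have "\<exists>h. legal_history X h \<and> follows Player_T Player_F \<sigma> h \<and> length h = 2 * n \<and>
      potential \<phi> h \<le> potential \<phi> []" if "2 * n \<le> card X" for n
    using that
  proof (induction n)
    case 0
    then show ?case by (intro exI[of _ "[]"]) auto
  next
    case (Suc n)
    then obtain h where h: "legal_history X h" "follows Player_T Player_F \<sigma> h"
      "length h = 2 * n" "potential \<phi> h \<le> potential \<phi> []"
      by auto
    define M where "M = (X - fst ` set h) \<times> (UNIV :: bool set)"
    have "\<not> complete_history X h"
      using Suc.prems h fin by (simp add: complete_history_iff_length)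
    then have "M \<noteq> {}" and "finite M"
      using h(1) fin by (auto simp: M_def complete_history_def legal_history_def)
    then obtain m where m: "m \<in> M" "\<And>m'. m' \<in> M \<Longrightarrow> bias \<phi> h m' \<le> bias \<phi> h m"
      using obtains_MAX by (metis Max_ge finite_imageI imageI)
    obtain x v where xv: "m = (x, v)" by (cases m)
    let ?h = "h @ [(x, v)]"
    obtain y u where yu: "\<sigma> ?h = (y, u)" by (cases "\<sigma> ?h")
    have h': "legal_history X ?h" "follows Player_T Player_F \<sigma> ?h"
      using h m(1) by (auto simp: legal_history_snoc follows_snoc mover_def M_def xv)
    have mover: "mover Player_T (length ?h) = Player_F"
      using h(3) by (simp add: mover_def)
    have "\<not> complete_history X ?h"
      using h'(1) h(3) fin Suc.prems by (simp add: complete_history_iff_length)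
    then have y: "y \<in> X - fst ` set ?h"
      using \<sigma> h' mover yu unfolding winning_strategy_F_def by (metis fst_conv)
    \<comment> \<open>The negation of F's literal was also available to T, so the maximality of
      \<open>m\<close> gives the greedy condition.\<close>
    have "(y, \<not> u) \<in> M"
      using y by (auto simp: M_def)
    then have "potential \<phi> (h @ [(x, v), (y, u)]) \<le> potential \<phi> h"
      using m y xv uniform_clause[OF assms(2)] by (intro potential_round) (auto simp: M_def)
    moreover have "legal_history X (?h @ [(y, u)])" "follows Player_T Player_F \<sigma> (?h @ [(y, u)])"
      unfolding legal_history_snoc[of _ ?h] follows_snoc[of _ _ _ ?h]
      using h' y yu by auto
    ultimately show ?case
      using h by (intro exI[of _ "h @ [(x, v), (y, u)]"]) auto
  qed
  \<comment> \<open>As \<open>card X\<close> is even, whole rounds exhaust \<open>X\<close>.\<close>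
  from this[of "card X div 2"] ev obtain h where h: "legal_history X h"
    "follows Player_T Player_F \<sigma> h" "length h = card X" "potential \<phi> h \<le> potential \<phi> []"
    by auto
  then have complete: "complete_history X h"
    using fin by (simp add: complete_history_iff_length)
  then have "\<not> satisfies (assignment_of h) \<phi>"
    using \<sigma> h by (auto simp: winning_strategy_F_def)
  then have "1 \<le> potential \<phi> h"
    using potential_complete fin vars complete by blast
  with h(4) potential_Nil[OF assms(2)] show ?thesis by simp
qed


section \<open>The pairing formula\<close>

definition pair_clause :: "nat \<Rightarrow> nat set \<Rightarrow> nat clause" where
  "pair_clause k S = (\<lambda>j. lit j (j div 2 \<in> S)) ` {..<k}"

definition pair_cnf :: "nat \<Rightarrow> nat cnf" where
  "pair_cnf k = pair_clause k ` Pow {..<(k + 1) div 2}"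

text \<open>For odd \<open>k\<close> this includes the variable \<open>k\<close>, which occurs in no
  clause: it gives \<open>k - 1\<close> a partner and makes the number of moves even.\<close>

definition pair_vars :: "nat \<Rightarrow> nat set" where
  "pair_vars k = {..<2 * ((k + 1) div 2)}"

definition partner :: "nat \<Rightarrow> nat" where
  "partner x = (if even x then x + 1 else x - 1)"

text \<open>F moves only after an odd number of moves, so \<open>last\<close> is never consulted on
  the empty history there.\<close>

definition copy_strategy :: "nat strategy" where
  "copy_strategy h = (partner (fst (last h)), snd (last h))"

lemma partner_partner [simp]: "partner (partner x) = x"
  by (auto simp: partner_def)

lemma partner_neq [simp]: "partner x \<noteq> x"
  by (auto simp: partner_def elim!: oddE)

lemma partner_in_pair_vars: "x \<in> pair_vars k \<Longrightarrow> partner x \<in> pair_vars k"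
  by (auto simp: pair_vars_def partner_def)

lemma card_pair_cnf_le: "card (pair_cnf k) \<le> 2 ^ ((k + 1) div 2)"
  unfolding pair_cnf_def by (metis card_Pow card_image_le card_lessThan finite_Pow_iff finite_lessThan)

lemma game_instance_pair: "game_instance (pair_cnf k) (pair_vars k)"
  by (auto simp: game_instance_def pair_cnf_def pair_clause_def pair_vars_def)

lemma uniform_pair: "uniform k (pair_cnf k)"
proof -
  have "card (pair_clause k S) = k" for S
    unfolding pair_clause_def by (subst card_image) (auto simp: inj_on_def)
  moreover have "lit_var ` pair_clause k S = {..<k}" for S
    by (auto simp: pair_clause_def image_image)
  ultimately show ?thesis
    by (auto simp: uniform_def pair_cnf_def pair_clause_def)
qed

text \<open>Induction removes one round, that is two moves, from the end: F's move in it is the copy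
  of T's.\<close>

lemma copy_strategy_paired:
  assumes "legal_history X h" "follows Player_T Player_F copy_strategy h" "even (length h)"
    and "(x, v) \<in> set h"
  shows "(partner x, v) \<in> set h"
  using assms
proof (induction "length h" arbitrary: h rule: less_induct)
  case less
  show ?case
  proof (cases h rule: rev_cases)
    case Nil
    with less.prems show ?thesis by simp
  next
    case h: (snoc g m)
    show ?thesis
    proof (cases g rule: rev_cases)
      case Nil
      with less.prems h show ?thesis by simp
    next
      case g: (snoc f m')
      have "follows Player_T Player_F copy_strategy g" "legal_history X g" "odd (length g)"
        "mover Player_T (length g) = Player_F \<longrightarrow> m = copy_strategy g"
        using less.prems(1-3) unfolding h by (simp_all add: follows_snoc legal_history_snoc)
      then have f: "follows Player_T Player_F copy_strategy f" "legal_history X f" "even (length f)"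
        and "m = (partner (fst m'), snd m')"
        unfolding g by (simp_all add: follows_snoc legal_history_snoc mover_def copy_strategy_def)
      moreover have "(x, v) \<in> set f \<Longrightarrow> (partner x, v) \<in> set f"
        using less.hyps[of f] f h g by simp
      ultimately show ?thesis
        using less.prems(4) h g by (cases m') auto
    qed
  qed
qed

lemma F_wins_pair: "F_wins (pair_cnf k) (pair_vars k) Player_T"
proof -
  have "partner (fst (last h)) \<in> pair_vars k - fst ` set h"
    if h: "legal_history (pair_vars k) h" "follows Player_T Player_F copy_strategy h"
      "mover Player_T (length h) = Player_F" for h
  proof -
    have "odd (length h)" using h(3) by (auto simp: mover_def split: if_splits)
    then obtain g x v where g: "h = g @ [(x, v)]" "even (length g)"
      by (cases h rule: rev_cases) auto
    then have g': "legal_history (pair_vars k) g" "x \<in> pair_vars k" "x \<notin> fst ` set g"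
      "follows Player_T Player_F copy_strategy g"
      using h by (auto simp: legal_history_snoc follows_snoc)
    \<comment> \<open>Before T's move \<open>g\<close> consists of whole rounds; if the partner were
      assigned in \<open>g\<close>, then so would be \<open>x\<close>.\<close>
    have "partner x \<notin> fst ` set g"
    proof
      assume "partner x \<in> fst ` set g"
      then obtain w where "(partner x, w) \<in> set g" by auto
      from copy_strategy_paired[OF g'(1,4) g(2) this] g'(3) show False by force
    qed
    with g g' show ?thesis
      by (simp add: partner_in_pair_vars)
  qed
  moreover have "\<not> satisfies (assignment_of h) (pair_cnf k)"
    if h: "complete_history (pair_vars k) h" "follows Player_T Player_F copy_strategy h" for h
  proof -
    have leg: "legal_history (pair_vars k) h"
      using h(1) by (simp add: complete_history_def)
    have "length h = card (pair_vars k)"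
      using h(1) leg by (subst (asm) complete_history_iff_length) (auto simp: pair_vars_def)
    then have "even (length h)"
      by (simp add: pair_vars_def)
    note paired = copy_strategy_paired[OF leg h(2) this]
    have same: "assignment_of h (partner x) = assignment_of h x" for x
      unfolding assignment_of_def using paired by (metis partner_partner)
    \<comment> \<open>\<open>S\<close> gives each pair the sign opposite to its common value, so its
      clause is falsified.\<close>
    define S where "S = {i. i < (k + 1) div 2 \<and> \<not> assignment_of h (2 * i)}"
    have "assignment_of h j \<noteq> (j div 2 \<in> S)" if "j < k" for j
    proof -
      have "assignment_of h j = assignment_of h (2 * (j div 2))"
        using same[of j] by (cases "even j") (auto simp: partner_def elim!: oddE)
      then show ?thesis using that by (auto simp: S_def)
    qed
    then have "\<not> lit_holds (assignment_of h) l" if "l \<in> pair_clause k S" for l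
      using that by (auto simp: pair_clause_def)
    moreover have "pair_clause k S \<in> pair_cnf k"
      by (auto simp: pair_cnf_def S_def)
    ultimately show ?thesis
      by (auto simp: satisfies_def)
  qed
  ultimately have "winning_strategy_F (pair_cnf k) (pair_vars k) Player_T copy_strategy"
    by (simp add: winning_strategy_F_def copy_strategy_def)
  then show ?thesis
    by (auto simp: F_wins_def)
qed

section \<open>Both bounds for the minimum, and their values for even and odd
  \<open>k\<close>\<close>

lemma min_clauses_T_F_bounds:
  "1 \<le> min_clauses k Player_T Player_F * weight k"
  "min_clauses k Player_T Player_F \<le> 2 ^ ((k + 1) div 2)"
proof -
  let ?A = "{card \<phi> | (\<phi> :: nat cnf) X. game_instance \<phi> X \<and> uniform k \<phi> \<and>
      pattern Player_T Player_F X \<and> F_wins \<phi> X Player_T}"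
  have "pattern Player_T Player_F (pair_vars k)"
    by (simp add: pattern_def pair_vars_def)
  then have mem: "card (pair_cnf k) \<in> ?A"
    using game_instance_pair uniform_pair F_wins_pair by blast
  \<comment> \<open>The pairing instance makes the set nonempty, so the infimum is attained and the
    lower bound applies to an instance attaining it.\<close>
  then have "Inf ?A \<in> ?A"
    by (intro Inf_nat_def1) blast
  then show "1 \<le> min_clauses k Player_T Player_F * weight k"
    unfolding min_clauses_def using F_wins_imp_card_ge by fastforce
  have "Inf ?A \<le> card (pair_cnf k)"
    using mem by (intro cInf_lower) auto
  then show "min_clauses k Player_T Player_F \<le> 2 ^ ((k + 1) div 2)"
    unfolding min_clauses_def using card_pair_cnf_le order_trans by blast
qed

theorem theorem1:
  fixes k :: nat
  shows "(even k \<longrightarrow> real (min_clauses k Player_T Player_F) = sqrt 2 ^ k) \<and>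
         (odd k \<longrightarrow>
            3 / 2 * sqrt 2 ^ (k - 1) \<le> real (min_clauses k Player_T Player_F) \<and>
            real (min_clauses k Player_T Player_F) \<le> sqrt 2 ^ (k + 1))"
proof (cases "even k")
  case True
  then obtain n where k: "k = 2 * n" by (elim evenE)
  have "real (min_clauses k Player_T Player_F) \<le> real (2 ^ n)"
    using min_clauses_T_F_bounds(2)[of k] k by (intro of_nat_mono) simp
  \<comment> \<open>\<open>weight (2 * n)\<close> is the inverse of \<open>2 ^ n\<close>, so the two
    bounds coincide.\<close>
  moreover have "real (min_clauses k Player_T Player_F) \<ge> 2 ^ n"
    using min_clauses_T_F_bounds(1)[of k] k by (simp add: weight_def field_simps)
  ultimately show ?thesis
    using k by (simp add: power_mult)
next
  case False
  then obtain n where k: "k = 2 * n + 1" by (elim oddE)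
  have "real (min_clauses k Player_T Player_F) \<le> real (2 ^ (n + 1))"
    using min_clauses_T_F_bounds(2)[of k] k by (intro of_nat_mono) simp
  \<comment> \<open>The odd weight carries the factor 2/3, whose inverse appears here.\<close>
  moreover have "real (min_clauses k Player_T Player_F) \<ge> 3 / 2 * 2 ^ n"
    using min_clauses_T_F_bounds(1)[of k] k by (simp add: weight_def field_simps)
  ultimately show ?thesis
    using k by (simp add: power_mult mult.assoc [symmetric])
qed

end
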